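(* Let $n\ge 2$. Let $U$ and $v$ be non-negative measurable functions on $\mathbb{S}^{n-1}$ and $\mathbb{R}^n$, respectively, and assume that the weighted restriction inequality $$\left(\int_{\mathbb{S}^{n-1}}|\widehat f(\omega)|^q\,U(\omega)\,d\sigma(\omega)\right)^{1/q}\le C\left(\int_{\mathbb{R}^n}|f(x)|^p v(x)\,dx\right)^{1/p},\qquad f\in C_0^\infty(\mathbb{R}^n),$$ holds for some $1\le p\le q\le\infty$. Let $w(\rho)$ be a measurable function for which $v(\rho x)\le w(\rho)v(x)$ for a.e. $\rho>0$ and $x\in\mathbb{R}^n$. Suppose that $u$ is a non-negative measurable function on $\mathbb{R}^n$ which is radial, and that $u(x)=u_0(|x|)$ satisfies $$\int_0^\infty \rho^{\,n-1-\frac{qn}{p'}}\,u_0(\rho)\,w^{q/p}(\rho)\,d\rho<\infty .$$ Then, for $f\in C_0^\infty(\mathbb{R}^n)$, $$\left(\int_{\mathbb{R}^n}|\widehat f(x)|^q\,U\!\left(\frac{x}{|x|}\right)u(x)\,dx\right)^{1/q}\le C\|v^{1/p}f\|_p .$$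
   Context: The Fourier transform is $\widehat f(\xi)=\int_{\mathbb{R}^n}e^{ix\xi}f(x)\,dx$. $d\sigma$ is the induced Lebesgue (surface) measure on the unit sphere $\mathbb{S}^{n-1}$ of $\mathbb{R}^n$. $\|\cdot\|_p$ is the standard norm of $L^p(\mathbb{R}^n)$, and $p'=p/(p-1)$ is the conjugate exponent of $p$ (with $1/p'=0$ when $p=1$). $C$ denotes constants, independent of $f$, that may differ from one inequality to the other. *)

theory Defs
  imports "HOL-Analysis.Analysis" "HOL-Probability.Essential_Supremum"
begin

text \<open>
  Surface measure on the unit sphere: the surface area of \<open>A\<close> is the dimension times the Lebesgue
  measure of the cone \<open>{r \<omega> | 0 < r \<le> 1, \<omega> \<in> A}\<close> over \<open>A\<close>.  It is not normalised: the total mass is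
  the surface area of the sphere (both facts are proved below).  It lives on the Borel subsets
  of the sphere; the Lebesgue measurable sets of the sphere are those of its completion.
\<close>

definition sphere_measure :: "'a::euclidean_space measure" where
  "sphere_measure =
     scale_measure (of_nat DIM('a))
       (distr (restrict_space lborel (cball 0 1 - {0})) (restrict_space borel (sphere 0 1))
          (\<lambda>x. x /\<^sub>R norm x))"

lemma space_sphere_measure: "space (sphere_measure :: 'a::euclidean_space measure) = sphere 0 1"
  by (simp add: sphere_measure_def space_scale_measure space_restrict_space)

lemma sets_sphere_measure:
  "sets (sphere_measure :: 'a::euclidean_space measure) = sets (restrict_space borel (sphere 0 1))"
  by (simp add: sphere_measure_def)

lemma emeasure_sphere_measure:
  fixes A :: "'a::euclidean_space set"
  assumes A: "A \<in> sets borel" "A \<subseteq> sphere 0 1"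
  shows "emeasure sphere_measure A =
    of_nat DIM('a) * emeasure lborel {r *\<^sub>R \<omega> |r \<omega>. 0 < r \<and> r \<le> 1 \<and> \<omega> \<in> A}"
proof -
  let ?B = "cball 0 1 - {0} :: 'a set" and ?h = "\<lambda>x::'a. x /\<^sub>R norm x"
  have B: "?B \<in> sets lborel" by simp
  have h: "?h \<in> measurable (restrict_space lborel ?B) (restrict_space borel (sphere 0 1))"
  proof (rule measurable_restrict_space2)
    show "?h \<in> space (restrict_space lborel ?B) \<rightarrow> sphere 0 1"
      by (auto simp: space_restrict_space)
    show "?h \<in> borel_measurable (restrict_space lborel ?B)"
      by (intro measurable_restrict_space1) measurable
  qed
  have AS: "A \<in> sets (restrict_space borel (sphere 0 1))"
    using A by (subst sets_restrict_space_iff) auto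
  let ?R = "{r *\<^sub>R \<omega> |r \<omega>. 0 < r \<and> r \<le> 1 \<and> \<omega> \<in> A}"
  have eq: "?h -` A \<inter> ?B = ?R" (is "?L = _")
  proof (intro set_eqI iffI)
    fix x assume "x \<in> ?L"
    then show "x \<in> ?R"
      by (intro CollectI exI[of _ "norm x"] exI[of _ "?h x"]) auto
  next
    fix x assume "x \<in> ?R"
    then show "x \<in> ?L" using A(2) by force
  qed
  have "?R \<subseteq> ?B"
    using eq by blast
  then have "emeasure (restrict_space lborel ?B) ?R = emeasure lborel ?R"
    by (intro emeasure_restrict_space) auto
  then show ?thesis
    by (simp add: sphere_measure_def emeasure_distr[OF h AS] space_restrict_space eq)
qed

lemma emeasure_sphere_measure_space:
  "emeasure sphere_measure (sphere 0 1 :: 'a::euclidean_space set) =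
     ennreal (real DIM('a) * unit_ball_vol (real DIM('a)))"
proof -
  have "{r *\<^sub>R \<omega> |r \<omega>. 0 < r \<and> r \<le> 1 \<and> \<omega> \<in> sphere (0::'a) 1} = cball 0 1 - {0}"
    (is "?L = ?R")
  proof (intro set_eqI iffI)
    fix x assume "x \<in> ?R"
    then show "x \<in> ?L"
      by (intro CollectI exI[of _ "norm x"] exI[of _ "x /\<^sub>R norm x"]) auto
  qed auto
  moreover have "emeasure lborel (cball 0 1 - {0} :: 'a set) = emeasure lborel (cball 0 1 :: 'a set)"
    by (subst emeasure_Diff) auto
  ultimately show ?thesis
    by (simp add: emeasure_sphere_measure emeasure_cball ennreal_mult ennreal_of_nat_eq_real_of_nat)
qed

text \<open>
  \<open>C\<^sup>k\<close> by recursion: every directional derivative \<open>x \<mapsto> f'(x) d\<close> is required to be \<open>C\<^sup>k\<^sup>-\<^sup>1\<close>.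
\<close>

primrec continuously_differentiable ::
    "nat \<Rightarrow> ('a::euclidean_space \<Rightarrow> complex) \<Rightarrow> bool" where
  "continuously_differentiable 0 f \<longleftrightarrow> continuous_on UNIV f"
| "continuously_differentiable (Suc k) f \<longleftrightarrow>
     (\<forall>x. f differentiable (at x)) \<and>
     (\<forall>d. continuously_differentiable k (\<lambda>x. frechet_derivative f (at x) d))"

definition test_functions :: "('a::euclidean_space \<Rightarrow> complex) set" where
  "test_functions =
     {f. (\<forall>k. continuously_differentiable k f) \<and> compact (closure {x. f x \<noteq> 0})}"

definition fourier :: "('a::euclidean_space \<Rightarrow> complex) \<Rightarrow> 'a \<Rightarrow> complex" where
  "fourier f \<xi> = (LINT x|lborel. exp (\<i> * complex_of_real (x \<bullet> \<xi>)) * f x)"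

text \<open>Only used for \<open>a > 0\<close>.\<close>

definition ennreal_powr :: "ennreal \<Rightarrow> real \<Rightarrow> ennreal" where
  "ennreal_powr x a = (if x = \<infinity> then \<infinity> else ennreal (enn2real x powr a))"

text \<open>
  The weighted norm \<open>(\<integral> |g|\<^sup>p W dM)\<^bsup>1/p\<^esup>\<close>, that is, the norm of \<open>L\<^sup>p(W dM)\<close>, with values in
  \<open>[0, \<infinity>]\<close>.  For \<open>p = \<infinity>\<close> it is the essential supremum with respect to \<open>W dM\<close>.
\<close>

definition weighted_Lp_norm ::
    "ennreal \<Rightarrow> 'a measure \<Rightarrow> ('a \<Rightarrow> real) \<Rightarrow> ('a \<Rightarrow> complex) \<Rightarrow> ennreal" where
  "weighted_Lp_norm p M W g =
     (if p = \<infinity> then esssup (density M (\<lambda>x. ennreal (W x))) (\<lambda>x. ennreal (norm (g x)))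
      else ennreal_powr (\<integral>\<^sup>+x. ennreal (norm (g x) powr enn2real p * W x) \<partial>M) (1 / enn2real p))"

abbreviation Lp_norm :: "ennreal \<Rightarrow> ('a::euclidean_space \<Rightarrow> complex) \<Rightarrow> ennreal" where
  "Lp_norm p g \<equiv> weighted_Lp_norm p lebesgue (\<lambda>_. 1) g"

text \<open>
  For \<open>p = 1\<close> the quotient is \<open>1 / 0 = \<infinity>\<close>.  In \<open>ennreal\<close>, \<open>\<infinity> / \<infinity> = 0\<close>, so \<open>p = \<infinity>\<close> is a separate case.
\<close>

definition conjugate_exponent :: "ennreal \<Rightarrow> ennreal" where
  "conjugate_exponent p = (if p = \<infinity> then 1 else p / (p - 1))"

text \<open>The real number \<open>1/p\<close>, with \<open>1/\<infinity> = 0\<close>.\<close>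

abbreviation recip :: "ennreal \<Rightarrow> real" where
  "recip p \<equiv> enn2real (1 / p)"

lemma recip_conjugate_exponent:
  assumes "1 \<le> p"
  shows "recip (conjugate_exponent p) = 1 - recip p"
proof (cases p)
  case (real r)
  with assms have r: "1 \<le> r" by (simp flip: ennreal_1)
  show ?thesis
  proof (cases "r = 1")
    case True
    then show ?thesis using real by (simp add: conjugate_exponent_def)
  next
    case False
    with r have r': "1 < r" by simp
    have "p - 1 = ennreal (r - 1)"
      using real r by (metis ennreal_1 ennreal_minus zero_le_one)
    then have "conjugate_exponent p = ennreal (r / (r - 1))"
      using real r' by (simp add: conjugate_exponent_def divide_ennreal)
    moreover have "1 / ennreal s = ennreal (1 / s)" if "0 < s" for s
      using that by (metis divide_ennreal ennreal_1 zero_le_one)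
    ultimately show ?thesis
      using real r' by (simp add: field_simps)
  qed
next
  case top
  then show ?thesis by (simp add: conjugate_exponent_def)
qed

end

theory Submission
  imports Defs
begin

text \<open>
  The dilate \<open>\<rho>\<^sup>-\<^sup>n f(x / \<rho>)\<close> has Fourier transform \<open>\<xi> \<mapsto> fourier f (\<rho> \<xi>)\<close>, so the restriction
  inequality applied to it bounds \<open>fourier f\<close> on the sphere of radius \<open>\<rho>\<close>; by the dilation
  hypothesis on \<open>v\<close> the constant grows at most by \<open>K \<rho> = \<rho>\<^bsup>-n/p'\<^esup> w(\<rho>)\<^bsup>1/p\<^esup>\<close>.  In polar
  coordinates the norm of \<open>fourier f\<close> is the \<open>L\<^sup>q(\<rho>\<^bsup>n-1\<^esup> u0(\<rho>) d\<rho>)\<close> norm of these spherical norms,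
  and the hypothesis on \<open>u0\<close> says exactly that \<open>K\<close> has finite norm in that space.
\<close>

section \<open>Polar coordinates\<close>

text \<open>The junk value at \<open>0\<close> is a unit vector, so that the map takes values in the sphere everywhere.\<close>

definition sphere_direction :: "'a::euclidean_space \<Rightarrow> 'a" where
  "sphere_direction x = (if x = 0 then SOME i. i \<in> Basis else x /\<^sub>R norm x)"

lemma norm_sphere_direction [simp]: "norm (sphere_direction x) = 1"
  by (auto simp: sphere_direction_def intro!: norm_Basis someI_ex[of "\<lambda>i. i \<in> Basis"] nonempty_Basis[unfolded ex_in_conv[symmetric]])

lemma sphere_direction_nonzero: "x \<noteq> 0 \<Longrightarrow> sphere_direction x = x /\<^sub>R norm x"
  by (simp add: sphere_direction_def)

lemma norm_scaleR_sphere_direction [simp]: "norm x *\<^sub>R sphere_direction x = x"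
  by (simp add: sphere_direction_def)

lemma sphere_direction_scaleR:
  "0 < r \<Longrightarrow> x \<noteq> 0 \<Longrightarrow> sphere_direction (r *\<^sub>R x) = sphere_direction x"
  by (simp add: sphere_direction_def)

lemma measurable_id_sphere_measure [measurable]:
  "(\<lambda>x. x) \<in> measurable sphere_measure (borel :: 'a::euclidean_space measure)"
  by (simp add: measurable_cong_sets[OF sets_sphere_measure refl] measurable_restrict_space1)

lemma measurable_sphere_direction [measurable]:
  "sphere_direction \<in> measurable borel (sphere_measure :: 'a::euclidean_space measure)"
proof -
  have "sphere_direction \<in> measurable borel (borel :: 'a measure)"
    unfolding sphere_direction_def by measurable
  then show ?thesis
    by (auto simp: measurable_cong_sets[OF refl sets_sphere_measure] intro!: measurable_restrict_space2)
qed

lemma finite_measure_sphere_measure: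
  "finite_measure (sphere_measure :: 'a::euclidean_space measure)"
  by (rule finite_measureI) (simp add: space_sphere_measure emeasure_sphere_measure_space)

text \<open>The radial factor of Lebesgue measure in dimension \<open>n\<close>. It is a measure on
  all of \<open>borel\<close>, with an indicator removing the radii \<open>\<rho> \<le> 0\<close>,
  so that closed half-lines generate its sigma-algebra.\<close>

definition radial_measure :: "nat \<Rightarrow> real measure" where
  "radial_measure n = density lborel (\<lambda>\<rho>. ennreal (\<rho> ^ (n - 1)) * indicator {0<..} \<rho>)"

lemma sets_radial_measure [measurable_cong, simp]: "sets (radial_measure n) = sets borel"
  by (simp add: radial_measure_def)

lemma space_radial_measure [simp]: "space (radial_measure n) = UNIV"
  by (simp add: radial_measure_def)

lemma sigma_finite_radial_measure: "sigma_finite_measure (radial_measure n)"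
  unfolding radial_measure_def
  by (subst sigma_finite_measure.sigma_finite_iff_density_finite[OF sigma_finite_lborel]) (auto simp: indicator_def)

lemma nn_integral_radial_measure:
  "f \<in> borel_measurable borel \<Longrightarrow>
    (\<integral>\<^sup>+\<rho>. f \<rho> \<partial>radial_measure n) = (\<integral>\<^sup>+\<rho>. ennreal (\<rho> ^ (n - 1)) * indicator {0<..} \<rho> * f \<rho> \<partial>lborel)"
  unfolding radial_measure_def by (rule nn_integral_density) auto

text \<open>The density is strictly positive at every \<open>\<rho> > 0\<close>, so on the positive
  half-line the null sets are those of Lebesgue measure.\<close>

lemma AE_radial_measure_iff:
  "(AE \<rho> in radial_measure n. P \<rho>) \<longleftrightarrow> (AE \<rho> in lborel. 0 < \<rho> \<longrightarrow> P \<rho>)"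
  unfolding radial_measure_def
  by (subst AE_density) (auto intro!: AE_cong simp: ennreal_zero_less_mult_iff indicator_def)

lemma emeasure_radial_measure_atMost:
  assumes "0 < n"
  shows "emeasure (radial_measure n) {..r} = (if 0 < r then ennreal (r ^ n / n) else 0)"
proof -
  have "emeasure (radial_measure n) {..r} =
      (\<integral>\<^sup>+\<rho>. ennreal (\<rho> ^ (n - 1)) * indicator {0<..} \<rho> * indicator {..r} \<rho> \<partial>lborel)"
    unfolding radial_measure_def by (rule emeasure_density) auto
  also have "\<dots> = (if 0 < r then ennreal (r ^ n / n) else 0)"
  proof (cases "0 < r")
    case True
    \<comment> \<open>The endpoint 0 is a null set; adding it gives the closed interval to which the
      fundamental theorem of calculus applies.\<close>
    have "(\<integral>\<^sup>+\<rho>. ennreal (\<rho> ^ (n - 1)) * indicator {0<..} \<rho> * indicator {..r} \<rho> \<partial>lborel) =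
        (\<integral>\<^sup>+\<rho>. ennreal (\<rho> ^ (n - 1)) * indicator {0..r} \<rho> \<partial>lborel)"
      using AE_lborel_singleton[of "0::real"]
      by (intro nn_integral_cong_AE) (auto simp: indicator_def elim!: eventually_mono)
    also have "\<dots> = ennreal (r ^ n / n - 0 ^ n / n)"
    proof (rule nn_integral_FTC_Icc)
      fix x show "((\<lambda>x. x ^ n / real n) has_real_derivative x ^ (n - 1)) (at x)"
        using assms by (auto intro!: derivative_eq_intros)
    qed (use True in auto)
    finally show ?thesis using True assms by (simp add: zero_power)
  next
    case False
    then have "(\<lambda>\<rho>. ennreal (\<rho> ^ (n - 1)) * indicator {0<..} \<rho> * indicator {..r} \<rho>) = (\<lambda>_. 0)"
      by (auto simp: fun_eq_iff indicator_def)
    then show ?thesis using False by simp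
  qed
  finally show ?thesis .
qed

lemma nn_integral_lborel_scaleR:
  fixes f :: "'a::euclidean_space \<Rightarrow> ennreal"
  assumes [measurable]: "f \<in> borel_measurable borel" and c: "c \<noteq> 0"
  shows "(\<integral>\<^sup>+x. f x \<partial>lborel) = ennreal (\<bar>c\<bar> ^ DIM('a)) * (\<integral>\<^sup>+x. f (c *\<^sub>R x) \<partial>lborel)"
  by (subst lborel_affine[OF c, of 0])
     (simp add: nn_integral_density nn_integral_distr nn_integral_cmult)

text \<open>Dilation by \<open>r\<close> carries the cone of height 1 over \<open>B\<close> to the
  cone of height \<open>r\<close>, and by definition the surface measure of \<open>B\<close> is
  \<open>DIM('a)\<close> times the volume of the cone of height 1.\<close>

lemma emeasure_truncated_cone:
  fixes B :: "'a::euclidean_space set"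
  assumes B: "B \<in> sets sphere_measure" and r: "0 < r"
  shows "emeasure lborel {x. x \<noteq> 0 \<and> norm x \<le> r \<and> sphere_direction x \<in> B} =
    ennreal (r ^ DIM('a) / DIM('a)) * emeasure sphere_measure B"
proof -
  let ?D = "\<lambda>r. {x::'a. x \<noteq> 0 \<and> norm x \<le> r \<and> sphere_direction x \<in> B}"
  have B': "B \<in> sets borel" "B \<subseteq> sphere 0 1"
    using B unfolding sets_sphere_measure by (subst (asm) sets_restrict_space_iff; simp)+
  have [measurable]: "?D r \<in> sets borel" for r
    using B by measurable
  have "emeasure lborel (?D r) = (\<integral>\<^sup>+x. indicator (?D r) x \<partial>lborel)"
    by simp
  also have "\<dots> = ennreal (r ^ DIM('a)) * (\<integral>\<^sup>+x. indicator (?D r) (r *\<^sub>R x) \<partial>lborel)"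
    using r by (subst nn_integral_lborel_scaleR[of _ r]) auto
  also have "(\<lambda>x. indicator (?D r) (r *\<^sub>R x) :: ennreal) = indicator (?D 1)"
    using r by (auto simp: fun_eq_iff indicator_def sphere_direction_scaleR)
  also have "(\<integral>\<^sup>+x. indicator (?D 1) x \<partial>lborel) = emeasure lborel (?D 1)"
    by simp
  also have "?D 1 = {r *\<^sub>R \<omega> |r \<omega>. 0 < r \<and> r \<le> 1 \<and> \<omega> \<in> B}" (is "_ = ?R")
  proof (intro set_eqI iffI)
    fix x assume "x \<in> ?D 1"
    then show "x \<in> ?R"
      by (intro CollectI exI[of _ "norm x"] exI[of _ "sphere_direction x"]) auto
  next
    fix x assume "x \<in> ?R"
    then show "x \<in> ?D 1" using B'(2) by (force simp: sphere_direction_def)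
  qed
  finally have *: "emeasure lborel (?D r) = ennreal (r ^ DIM('a)) * emeasure lborel ?R" .
  have "ennreal (r ^ DIM('a) / DIM('a)) * emeasure sphere_measure B =
      ennreal (r ^ DIM('a)) * (ennreal (1 / DIM('a)) * of_nat DIM('a)) * emeasure lborel ?R"
    using r by (simp add: emeasure_sphere_measure[OF B'] mult.assoc ennreal_mult'[symmetric] divide_inverse
       flip: ennreal_of_nat_eq_real_of_nat) (simp add: ennreal_mult mult.assoc)
  also have "ennreal (1 / DIM('a)) * of_nat DIM('a) = 1"
    by (simp add: ennreal_of_nat_eq_real_of_nat flip: ennreal_mult')
  finally show ?thesis using * by simp
qed

text \<open>A product of sigma-finite measures is determined by its values on rectangles
  \<open>A \<times> B\<close>. For fixed \<open>B\<close> both sides are Borel measures in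
  \<open>A\<close>, and it suffices to compare them on half-lines, where the volume of a truncated
  cone gives the answer.\<close>

lemma radial_measure_pair_sphere_measure:
  "radial_measure DIM('a) \<Otimes>\<^sub>M sphere_measure =
    distr lborel (borel \<Otimes>\<^sub>M sphere_measure) (\<lambda>x::'a::euclidean_space. (norm x, sphere_direction x))"
    (is "_ = ?M")
proof (rule pair_measure_eqI)
  show "sigma_finite_measure (radial_measure DIM('a))"
    by (rule sigma_finite_radial_measure)
  show "sigma_finite_measure (sphere_measure :: 'a measure)"
    using finite_measure_sphere_measure by (rule finite_measure.axioms)
  show "sets (radial_measure DIM('a) \<Otimes>\<^sub>M (sphere_measure :: 'a measure)) = sets ?M"
    by (simp cong: sets_pair_measure_cong)
next
  fix A and B :: "'a set"
  assume "A \<in> sets (radial_measure DIM('a))" and B[measurable]: "B \<in> sets sphere_measure"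
  then have A[measurable]: "A \<in> sets borel" by simp
  let ?C = "{x::'a. x \<noteq> 0 \<and> sphere_direction x \<in> B}"
  have C[measurable]: "?C \<in> sets borel" by measurable
  \<comment> \<open>\<open>M1\<close> distributes the volume of the full cone over \<open>B\<close>
    by radius; \<open>M2\<close> is what the product measure predicts for it.\<close>
  define M1 where "M1 = distr (density lborel (indicator ?C)) borel norm"
  define M2 where "M2 = scale_measure (emeasure sphere_measure B) (radial_measure DIM('a))"
  have M1: "emeasure M1 X = emeasure lborel {x. x \<noteq> 0 \<and> norm x \<in> X \<and> sphere_direction x \<in> B}"
    if [measurable]: "X \<in> sets borel" for X
  proof -
    have V: "norm -` X \<in> sets (borel :: 'a measure)"
      by (rule measurable_sets_borel[OF _ that]) simp
    have "emeasure M1 X = emeasure (density lborel (indicator ?C)) (norm -` X)"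
      unfolding M1_def by (subst emeasure_distr) auto
    also have "\<dots> = (\<integral>\<^sup>+x. indicator ?C x * indicator (norm -` X) x \<partial>lborel)"
      using V by (intro emeasure_density) auto
    also have "\<dots> = emeasure lborel (?C \<inter> norm -` X)"
      using V by (simp flip: indicator_inter_arith)
    also have "?C \<inter> norm -` X = {x. x \<noteq> 0 \<and> norm x \<in> X \<and> sphere_direction x \<in> B}" by auto
    finally show ?thesis .
  qed
  have fin: "emeasure sphere_measure B \<noteq> \<infinity>"
    using finite_measure.emeasure_finite[OF finite_measure_sphere_measure] by simp
  have eq: "emeasure M1 {..r} = emeasure M2 {..r}" for r
  proof (cases "0 < r")
    case True
    then show ?thesis
      by (simp add: M1 M2_def emeasure_radial_measure_atMost emeasure_truncated_cone[OF B] mult.commute)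
  next
    case False
    then have *: "{x::'a. x \<noteq> 0 \<and> norm x \<in> {..r} \<and> sphere_direction x \<in> B} = {}"
      by (auto dest: order.strict_trans2[OF iffD2[OF zero_less_norm_iff]])
    have "emeasure M1 {..r} = 0"
      by (subst M1) (simp_all only: * atMost_borel emeasure_empty)
    then show ?thesis
      using False by (simp add: M2_def emeasure_radial_measure_atMost)
  qed
  have "M1 = M2"
  \<comment> \<open>Half-lines form an intersection-stable generator; the exhausting sequence
    \<open>{..real i}\<close> has finite measure because the sphere has finite surface
    measure.\<close>
  proof (rule measure_eqI_generator_eq[where E="range (\<lambda>a. {..a})" and \<Omega>=UNIV and A="\<lambda>i. {..real i}"])
    show "Int_stable (range (\<lambda>a::real. {..a}))"
      by (auto simp: Int_stable_def)
    show "sets M1 = sigma_sets UNIV (range (\<lambda>a. {..a}))" "sets M2 = sigma_sets UNIV (range (\<lambda>a. {..a}))"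
      unfolding M1_def M2_def by (simp_all add: borel_eq_atMost)
    show "emeasure M1 X = emeasure M2 X" if "X \<in> range (\<lambda>a. {..a})" for X
      using that eq by auto
    show "emeasure M1 {..real i} \<noteq> \<infinity>" for i
      using fin unfolding eq by (auto simp: M2_def emeasure_radial_measure_atMost ennreal_mult_eq_top_iff)
    show "(\<Union>i. {..real i}) = UNIV" by (auto intro: real_arch_simple)
  qed auto
  then have "emeasure (radial_measure DIM('a)) A * emeasure sphere_measure B = emeasure M1 A"
    by (simp add: M2_def mult.commute)
  \<comment> \<open>The origin was left out of the cone because its direction is a junk value. It is
    a null set, so it can be put back.\<close>
  also have "\<dots> = emeasure lborel {x. norm x \<in> A \<and> sphere_direction x \<in> B}"
    unfolding M1[OF A] using AE_lborel_singleton[of "0::'a"]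
    by (intro emeasure_eq_AE) (auto elim!: eventually_mono)
  also have "\<dots> = emeasure ?M (A \<times> B)"
    by (subst emeasure_distr) (auto intro!: arg_cong[where f="emeasure lborel"])
  finally show "emeasure (radial_measure DIM('a)) A * emeasure sphere_measure B = emeasure ?M (A \<times> B)" .
qed

lemma nn_integral_polar:
  fixes F :: "'a::euclidean_space \<Rightarrow> ennreal"
  assumes [measurable]: "F \<in> borel_measurable borel"
  shows "(\<integral>\<^sup>+x. F x \<partial>lborel) =
    (\<integral>\<^sup>+\<rho>. \<integral>\<^sup>+\<omega>. F (\<rho> *\<^sub>R \<omega>) \<partial>sphere_measure \<partial>radial_measure DIM('a))"
proof -
  interpret finite_measure "sphere_measure :: 'a measure"
    by (rule finite_measure_sphere_measure)
  have "(\<integral>\<^sup>+\<rho>. \<integral>\<^sup>+\<omega>. F (\<rho> *\<^sub>R \<omega>) \<partial>sphere_measure \<partial>radial_measure DIM('a)) =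
     (\<integral>\<^sup>+z. F (fst z *\<^sub>R snd z) \<partial>(radial_measure DIM('a) \<Otimes>\<^sub>M sphere_measure))"
    by (subst nn_integral_fst[symmetric]) auto
  also have "\<dots> = (\<integral>\<^sup>+x. F x \<partial>lborel)"
    unfolding radial_measure_pair_sphere_measure by (subst nn_integral_distr) auto
  finally show ?thesis ..
qed

text \<open>The set where \<open>P\<close> fails is null iff its indicator has integral zero. In
  polar coordinates this is a vanishing iterated integral, hence one that vanishes on the sphere for
  almost every radius.\<close>

lemma AE_polar_iff:
  fixes P :: "'a::euclidean_space \<Rightarrow> bool"
  assumes [measurable]: "Measurable.pred borel P"
  shows "(AE x in lborel. P x) \<longleftrightarrow>
    (AE \<rho> in radial_measure DIM('a). AE \<omega> in sphere_measure. P (\<rho> *\<^sub>R \<omega>))"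
proof -
  interpret finite_measure "sphere_measure :: 'a measure"
    by (rule finite_measure_sphere_measure)
  have "(AE x in lborel. P x) \<longleftrightarrow> (\<integral>\<^sup>+x. indicator {x. \<not> P x} x \<partial>lborel) = 0"
    by (subst nn_integral_0_iff_AE) (auto simp: indicator_def)
  also have "\<dots> \<longleftrightarrow> (AE \<rho> in radial_measure DIM('a).
      (\<integral>\<^sup>+\<omega>. indicator {x. \<not> P x} (\<rho> *\<^sub>R \<omega>) \<partial>sphere_measure) = 0)"
    by (subst nn_integral_polar, simp, subst nn_integral_0_iff_AE) auto
  also have "\<dots> \<longleftrightarrow> (AE \<rho> in radial_measure DIM('a). AE \<omega> in sphere_measure. P (\<rho> *\<^sub>R \<omega>))"
    by (subst nn_integral_0_iff_AE) (auto simp: indicator_def intro!: AE_cong)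
  finally show ?thesis .
qed

section \<open>Powers and weighted norms\<close>

lemma ennreal_powr_ennreal: "0 \<le> x \<Longrightarrow> ennreal_powr (ennreal x) a = ennreal (x powr a)"
  by (simp add: ennreal_powr_def)

lemma ennreal_powr_top [simp]: "ennreal_powr top a = top"
  by (simp add: ennreal_powr_def)

lemma ennreal_powr_0 [simp]: "ennreal_powr 0 a = 0"
  by (simp add: ennreal_powr_def)

lemma ennreal_powr_mono:
  assumes "0 \<le> a" "x \<le> y"
  shows "ennreal_powr x a \<le> ennreal_powr y a"
proof (cases y)
  case (real s)
  with assms(2) obtain r where "0 \<le> r" "x = ennreal r" by (cases x) (auto simp: top_unique)
  with real assms show ?thesis
    by (auto simp: ennreal_powr_ennreal ennreal_le_iff intro!: ennreal_leI powr_mono2)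
qed (simp add: ennreal_powr_def)

lemma ennreal_powr_mult:
  assumes "0 < a"
  shows "ennreal_powr (x * y) a = ennreal_powr x a * ennreal_powr y a"
proof -
  \<comment> \<open>Since \<open>top * 0 = 0\<close>, the infinite cases agree as well: the power of
    \<open>z\<close> vanishes exactly when \<open>z\<close> does.\<close>
  have top: "ennreal_powr (top * z) a = top * ennreal_powr z a" for z
    by (cases z) (auto simp: ennreal_powr_def ennreal_top_mult ennreal_mult_top)
  show ?thesis
  proof (cases x; cases y)
    fix r s assume "0 \<le> r" "x = ennreal r" "0 \<le> s" "y = ennreal s"
    then show ?thesis
      by (simp add: ennreal_powr_ennreal powr_mult flip: ennreal_mult)
  qed (use top[of x] top[of y] ennreal_powr_top[of a] in \<open>simp_all add: mult.commute\<close>)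
qed

lemma ennreal_powr_powr: "ennreal_powr (ennreal_powr x a) b = ennreal_powr x (a * b)"
  by (cases x) (simp_all add: ennreal_powr_ennreal powr_powr ennreal_powr_def)

lemma ennreal_powr_1 [simp]: "ennreal_powr x 1 = x"
  by (cases x) (simp_all add: ennreal_powr_ennreal ennreal_powr_def)

lemma recip_ennreal: "0 < r \<Longrightarrow> recip (ennreal r) = 1 / r"
  by (metis divide_ennreal divide_nonneg_pos enn2real_ennreal ennreal_1 zero_le_one)

text \<open>The measure \<open>W dM\<close> charges only points with \<open>W > 0\<close>, so almost
  everywhere for it means almost everywhere for \<open>M\<close> on that set. If \<open>g\<close> is
  not measurable, the essential supremum is \<open>top\<close> by convention and the bound is
  trivial.\<close>

lemma AE_le_weighted_Lp_norm_top:
  assumes [measurable]: "W \<in> borel_measurable M"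
  shows "AE x in M. 0 < W x \<longrightarrow> ennreal (norm (g x)) \<le> weighted_Lp_norm top M W g"
proof -
  have "AE x in density M (\<lambda>x. ennreal (W x)). ennreal (norm (g x)) \<le> weighted_Lp_norm top M W g"
    unfolding weighted_Lp_norm_def infinity_ennreal_def by (simp only: refl if_True esssup_AE)
  then show ?thesis
    by (subst (asm) AE_density) auto
qed

text \<open>The converse bound. Measurability of \<open>g\<close> matters in this direction, because
  of the default value \<open>top\<close> of the essential supremum.\<close>

lemma weighted_Lp_norm_top_leI:
  assumes [measurable]: "W \<in> borel_measurable M" "g \<in> borel_measurable M"
    and "AE x in M. 0 < W x \<longrightarrow> ennreal (norm (g x)) \<le> E"
  shows "weighted_Lp_norm top M W g \<le> E"
proof -
  have "AE x in density M (\<lambda>x. ennreal (W x)). ennreal (norm (g x)) \<le> E"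
    using assms(3) by (subst AE_density) auto
  then show ?thesis
    unfolding weighted_Lp_norm_def infinity_ennreal_def by (auto intro: esssup_I)
qed

section \<open>Dilations\<close>

lemma lebesgue_scaleR:
  assumes "c \<noteq> 0"
  shows "lebesgue = density (distr lebesgue lebesgue (\<lambda>x::'a::euclidean_space. c *\<^sub>R x))
    (\<lambda>_. ennreal (\<bar>c\<bar> ^ DIM('a)))"
proof -
  \<comment> \<open>The dilation is the coordinatewise affine map whose factors all equal
    \<open>c\<close>.\<close>
  have "(\<lambda>x::'a. 0 + (\<Sum>j\<in>Basis. (c * (x \<bullet> j)) *\<^sub>R j)) = (\<lambda>x. c *\<^sub>R x)"
    by (simp add: scaleR_scaleR[symmetric] scaleR_sum_right[symmetric] euclidean_representation
        del: scaleR_scaleR)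
  then show ?thesis
    using lebesgue_affine_euclidean[of "\<lambda>_. c" "0::'a"] assms by simp
qed

lemma nn_integral_lebesgue_scaleR:
  fixes f :: "'a::euclidean_space \<Rightarrow> ennreal"
  assumes f[measurable]: "f \<in> borel_measurable lebesgue" and c: "c \<noteq> 0"
  shows "(\<integral>\<^sup>+x. f x \<partial>lebesgue) = ennreal (\<bar>c\<bar> ^ DIM('a)) * (\<integral>\<^sup>+x. f (c *\<^sub>R x) \<partial>lebesgue)"
proof -
  have f': "f \<in> borel_measurable (distr lebesgue lebesgue (\<lambda>x. c *\<^sub>R x))"
    using f by simp
  have "(\<integral>\<^sup>+x. f x \<partial>lebesgue) =
      ennreal (\<bar>c\<bar> ^ DIM('a)) * (\<integral>\<^sup>+x. f x \<partial>distr lebesgue lebesgue (\<lambda>x. c *\<^sub>R x))"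
    by (subst lebesgue_scaleR[OF c]) (use f' in \<open>simp add: nn_integral_density nn_integral_cmult\<close>)
  then show ?thesis
    by (simp add: nn_integral_distr)
qed

lemma AE_lebesgue_scaleR_iff:
  fixes P :: "'a::euclidean_space \<Rightarrow> bool"
  assumes c: "c \<noteq> 0"
  shows "(AE x in lebesgue. P (c *\<^sub>R x)) \<longleftrightarrow> (AE x in lebesgue. P x)"
proof -
  \<comment> \<open>One direction suffices, for every nonzero factor: the other one is the same
    statement for \<open>inverse c\<close>.\<close>
  have *: "AE x in lebesgue. P (c *\<^sub>R x)"
    if "c \<noteq> 0" "AE x in lebesgue. P x" for c and P :: "'a \<Rightarrow> bool"
  proof -
    have "AE x in density (distr lebesgue lebesgue (\<lambda>x::'a. c *\<^sub>R x)) (\<lambda>_. ennreal (\<bar>c\<bar> ^ DIM('a))). P x"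
      using that by (subst lebesgue_scaleR[symmetric]) auto
    then have "AE x in distr lebesgue lebesgue (\<lambda>x. c *\<^sub>R x). P x"
      using that by (simp add: AE_density)
    then show ?thesis
      by (rule AE_distrD[rotated]) simp
  qed
  show ?thesis
    using *[OF c, of P] *[of "inverse c" "\<lambda>x. P (c *\<^sub>R x)"] c by (intro iffI) simp_all
qed

section \<open>Test functions and Fourier transforms under dilation\<close>

definition dilate :: "real \<Rightarrow> ('a::euclidean_space \<Rightarrow> complex) \<Rightarrow> 'a \<Rightarrow> complex" where
  "dilate \<rho> f x = complex_of_real (inverse (\<rho> ^ DIM('a))) * f (inverse \<rho> *\<^sub>R x)"

lemma dilate_scaleR:
  "\<rho> \<noteq> 0 \<Longrightarrow> dilate \<rho> f (\<rho> *\<^sub>R x) = complex_of_real (inverse (\<rho> ^ DIM('a))) * f (x::'a::euclidean_space)"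
  by (simp add: dilate_def)

lemma borel_measurable_dilate [measurable]:
  assumes [measurable]: "f \<in> borel_measurable borel"
  shows "dilate \<rho> f \<in> borel_measurable borel"
  unfolding dilate_def[abs_def] by measurable

lemma borel_measurable_fourier [measurable]:
  assumes [measurable]: "f \<in> borel_measurable borel"
  shows "fourier f \<in> borel_measurable borel"
  unfolding fourier_def[abs_def] by measurable

text \<open>Substitute \<open>\<rho> *\<^sub>R x\<close> for \<open>x\<close>: the Jacobian cancels
  the normalising factor of \<open>dilate\<close>, and the inner product moves the dilation onto the
  frequency.\<close>

lemma fourier_dilate:
  fixes f :: "'a::euclidean_space \<Rightarrow> complex"
  assumes [measurable]: "f \<in> borel_measurable borel" and "0 < \<rho>"
  shows "fourier (dilate \<rho> f) \<xi> = fourier f (\<rho> *\<^sub>R \<xi>)"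
proof -
  let ?g = "\<lambda>x. exp (\<i> * complex_of_real (x \<bullet> \<xi>)) * dilate \<rho> f x"
  have "fourier (dilate \<rho> f) \<xi> =
      (LINT x|density (distr lborel borel (\<lambda>x. 0 + \<rho> *\<^sub>R x)) (\<lambda>_. ennreal (\<bar>\<rho>\<bar> ^ DIM('a))). ?g x)"
    unfolding fourier_def using assms(2) by (subst lborel_affine[of \<rho> 0]) auto
  also have "\<dots> = (LINT x|lborel. \<rho> ^ DIM('a) *\<^sub>R ?g (\<rho> *\<^sub>R x))"
    using assms(2) by (subst integral_density) (simp_all add: integral_distr)
  also have "\<dots> = fourier f (\<rho> *\<^sub>R \<xi>)"
    unfolding fourier_def using assms(2)
    by (intro Bochner_Integration.integral_cong) (simp_all add: dilate_scaleR scaleR_conv_of_real)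
  finally show ?thesis .
qed

text \<open>By the chain rule the derivative in direction \<open>d\<close> has the same shape, with
  \<open>f\<close> replaced by its derivative in direction \<open>c *\<^sub>R d\<close>. So the
  induction keeps \<open>a\<close> and \<open>c\<close> fixed and varies \<open>f\<close>.\<close>

lemma continuously_differentiable_dilate:
  "continuously_differentiable k f \<Longrightarrow> continuously_differentiable k (\<lambda>x. a * f (c *\<^sub>R x))"
proof (induction k arbitrary: f)
  case 0
  then show ?case
    by (auto intro!: continuous_intros continuous_on_compose2[of UNIV f])
next
  case (Suc k)
  have "((\<lambda>x. a * f (c *\<^sub>R x)) has_derivative
      (\<lambda>d. a * frechet_derivative f (at (c *\<^sub>R x)) (c *\<^sub>R d))) (at x)" for x
  proof -
    have "(f has_derivative frechet_derivative f (at (c *\<^sub>R x))) (at (c *\<^sub>R x))"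
      using Suc.prems by (simp flip: frechet_derivative_works)
    from diff_chain_at[OF has_derivative_scaleR_right[OF has_derivative_ident] this]
    show ?thesis
      by (auto simp: o_def intro!: has_derivative_mult_right)
  qed
  note D = this
  have "frechet_derivative (\<lambda>x. a * f (c *\<^sub>R x)) (at x) =
      (\<lambda>d. a * frechet_derivative f (at (c *\<^sub>R x)) (c *\<^sub>R d))" for x
    using frechet_derivative_at[OF D] by simp
  moreover have "continuously_differentiable k (\<lambda>x. frechet_derivative f (at x) (c *\<^sub>R d))" for d
    using Suc.prems by simp
  ultimately show ?case
    using D Suc.IH by (auto simp: differentiable_def)
qed

lemma test_functions_measurable:
  assumes "f \<in> test_functions"
  shows "f \<in> borel_measurable borel"
proof -
  have "continuously_differentiable 0 f"
    using assms unfolding test_functions_def by blast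
  then show ?thesis by (simp add: borel_measurable_continuous_onI)
qed

text \<open>The set where the dilate is nonzero is the scaled copy of that of \<open>f\<close>, and
  scaling commutes with closure and preserves compactness.\<close>

lemma dilate_in_test_functions:
  fixes f :: "'a::euclidean_space \<Rightarrow> complex"
  assumes f: "f \<in> test_functions" and "0 < \<rho>"
  shows "dilate \<rho> f \<in> test_functions"
proof -
  have "{x. dilate \<rho> f x \<noteq> 0} = (\<lambda>x. \<rho> *\<^sub>R x) ` {x. f x \<noteq> 0}"
  proof (intro set_eqI iffI)
    fix x assume "x \<in> {x. dilate \<rho> f x \<noteq> 0}"
    then show "x \<in> (\<lambda>x. \<rho> *\<^sub>R x) ` {x. f x \<noteq> 0}"
      using assms(2) by (intro image_eqI[of _ _ "inverse \<rho> *\<^sub>R x"]) (auto simp: dilate_def)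
  qed (use assms(2) in \<open>auto simp: dilate_def\<close>)
  then have "closure {x. dilate \<rho> f x \<noteq> 0} = (\<lambda>x. \<rho> *\<^sub>R x) ` closure {x. f x \<noteq> 0}"
    by (simp add: closure_scaleR)
  moreover have "continuously_differentiable k (dilate \<rho> f)" for k
    using f continuously_differentiable_dilate unfolding dilate_def[abs_def] test_functions_def by blast
  ultimately show ?thesis
    using f unfolding test_functions_def by (simp only: mem_Collect_eq compact_scaling simp_thms)
qed

text \<open>
  No sign of \<open>c\<close> is assumed: if \<open>c < 0\<close>, then \<open>v = 0\<close> almost everywhere, so both norms vanish
  whatever \<open>c powr recip p\<close> means.
\<close>

lemma weighted_Lp_norm_dilate_le:
  fixes f :: "'a::euclidean_space \<Rightarrow> complex"
  assumes f: "f \<in> borel_measurable borel"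
    and v[measurable]: "v \<in> borel_measurable lebesgue" and v0: "\<And>x. 0 \<le> v x"
    and p: "1 \<le> p" and \<rho>: "0 < \<rho>"
    and le: "AE x in lebesgue. v (\<rho> *\<^sub>R x) \<le> c * v x"
  shows "weighted_Lp_norm p lebesgue v (dilate \<rho> f) \<le>
    ennreal (\<rho> powr (- (real DIM('a) * recip (conjugate_exponent p))) * c powr recip p) *
    weighted_Lp_norm p lebesgue v f"
proof (cases p)
  case top
  let ?E = "weighted_Lp_norm p lebesgue v f"
  have [measurable]: "f \<in> borel_measurable lebesgue" "dilate \<rho> f \<in> borel_measurable lebesgue"
    using f by (auto intro: measurable_completion)
  have E: "AE x in lebesgue. 0 < v x \<longrightarrow> ennreal (norm (f x)) \<le> ?E"
    unfolding top by (rule AE_le_weighted_Lp_norm_top) measurable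
  \<comment> \<open>The estimate is made at \<open>\<rho> *\<^sub>R x\<close>, where the dilate is a
    constant multiple of \<open>f x\<close>, and is then carried back to \<open>x\<close> by the
    scaling invariance of null sets.\<close>
  have "AE x in lebesgue. 0 < v (\<rho> *\<^sub>R x) \<longrightarrow> ennreal (norm (dilate \<rho> f (\<rho> *\<^sub>R x))) \<le>
      ennreal (\<rho> powr - real DIM('a) * c powr 0) * ?E"
    using le E
  proof eventually_elim
    case (elim x)
    show ?case
    proof
      assume "0 < v (\<rho> *\<^sub>R x)"
      with elim(1) have "0 < c * v x" by linarith
      \<comment> \<open>Because \<open>0 powr 0 = 0\<close>, the factor \<open>c powr 0\<close> is 1
        only once \<open>c \<noteq> 0\<close> is known.\<close>
      with v0[of x] have c: "0 < v x" "c \<noteq> 0" by (auto simp: zero_less_mult_iff)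
      have "ennreal (norm (dilate \<rho> f (\<rho> *\<^sub>R x))) =
          ennreal (\<rho> powr - real DIM('a)) * ennreal (norm (f x))"
        using \<rho> by (simp add: dilate_scaleR norm_mult powr_minus powr_realpow norm_inverse norm_power
            flip: ennreal_mult)
      then show "ennreal (norm (dilate \<rho> f (\<rho> *\<^sub>R x))) \<le>
          ennreal (\<rho> powr - real DIM('a) * c powr 0) * ?E"
        using c elim(2) by (auto intro!: mult_left_mono)
    qed
  qed
  then have "AE x in lebesgue. 0 < v x \<longrightarrow> ennreal (norm (dilate \<rho> f x)) \<le>
      ennreal (\<rho> powr - real DIM('a) * c powr 0) * ?E"
    using \<rho> by (subst (asm) AE_lebesgue_scaleR_iff) auto
  then have "weighted_Lp_norm p lebesgue v (dilate \<rho> f) \<le>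
      ennreal (\<rho> powr - real DIM('a) * c powr 0) * ?E"
    unfolding top by (intro weighted_Lp_norm_top_leI) measurable
  then show ?thesis
    using recip_conjugate_exponent[OF p] by (simp add: top)
next
  case (real r)
  have r: "1 \<le> r"
    using p real by (simp flip: ennreal_1)
  have recip: "recip p = 1 / r"
    using real r by (simp add: recip_ennreal)
  have [measurable]: "f \<in> borel_measurable lebesgue" "dilate \<rho> f \<in> borel_measurable lebesgue"
    using f by (auto intro: measurable_completion)
  define n where "n = real DIM('a)"
  define b where "b = inverse (\<rho> ^ DIM('a))"
  have b: "b = \<rho> powr - n"
    using \<rho> by (simp add: b_def n_def powr_minus powr_realpow)
  let ?I = "\<integral>\<^sup>+x. ennreal (norm (f x) powr r * v x) \<partial>lebesgue"
  let ?J = "\<integral>\<^sup>+x. ennreal (norm (dilate \<rho> f x) powr r * v x) \<partial>lebesgue"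
  \<comment> \<open>As \<open>v \<ge> 0\<close>, the dilation bound survives replacing
    \<open>c\<close> by \<open>max 0 c\<close>, which makes the powers multiplicative. At the end
    \<open>c\<close> returns, since a negative \<open>c\<close> gives 0 on the smaller side.\<close>
  let ?c = "max 0 c"
  have "?J = ennreal (\<rho> ^ DIM('a)) *
      (\<integral>\<^sup>+x. ennreal (norm (dilate \<rho> f (\<rho> *\<^sub>R x)) powr r * v (\<rho> *\<^sub>R x)) \<partial>lebesgue)"
    using \<rho> by (subst nn_integral_lebesgue_scaleR[of _ \<rho>]) auto
  also have "\<dots> \<le> ennreal (\<rho> ^ DIM('a)) *
      (\<integral>\<^sup>+x. ennreal (b powr r * ?c) * ennreal (norm (f x) powr r * v x) \<partial>lebesgue)"
  proof (intro mult_left_mono nn_integral_mono_AE)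
    show "AE x in lebesgue. ennreal (norm (dilate \<rho> f (\<rho> *\<^sub>R x)) powr r * v (\<rho> *\<^sub>R x)) \<le>
        ennreal (b powr r * ?c) * ennreal (norm (f x) powr r * v x)"
      using le
    proof eventually_elim
      case (elim x)
      have "v (\<rho> *\<^sub>R x) \<le> ?c * v x"
        using elim mult_right_mono[OF max.cobounded2 v0[of x], of c 0] by linarith
      then have "(b powr r * norm (f x) powr r) * v (\<rho> *\<^sub>R x) \<le>
          (b powr r * norm (f x) powr r) * (?c * v x)"
        by (intro mult_left_mono) auto
      moreover have "norm (dilate \<rho> f (\<rho> *\<^sub>R x)) powr r = b powr r * norm (f x) powr r"
        using \<rho> by (simp add: dilate_scaleR b_def norm_mult norm_inverse norm_power powr_mult)
      ultimately show ?case
        using v0[of x] by (auto simp: mult_ac simp flip: ennreal_mult intro!: ennreal_leI)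
    qed
  qed simp
  also have "\<dots> = ennreal (\<rho> ^ DIM('a)) * (ennreal (b powr r * ?c) * ?I)"
    by (subst nn_integral_cmult) auto
  also have "\<dots> = ennreal (\<rho> powr (n - n * r) * ?c) * ?I"
  proof -
    have "\<rho> ^ DIM('a) * b powr r = \<rho> powr n * \<rho> powr (- n * r)"
      using \<rho> by (simp add: b powr_powr) (simp add: n_def powr_realpow)
    also have "\<dots> = \<rho> powr (n - n * r)"
      by (simp flip: powr_add)
    finally show ?thesis
      using \<rho> by (simp flip: ennreal_mult' mult.assoc)
  qed
  finally have "ennreal_powr ?J (1 / r) \<le> ennreal_powr (ennreal (\<rho> powr (n - n * r) * ?c) * ?I) (1 / r)"
    using r by (intro ennreal_powr_mono) auto
  also have "\<dots> = ennreal (\<rho> powr ((n - n * r) / r) * ?c powr (1 / r)) * ennreal_powr ?I (1 / r)"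
    using r \<rho> by (simp add: ennreal_powr_mult ennreal_powr_ennreal powr_mult powr_powr)
  also have "\<dots> \<le> ennreal (\<rho> powr ((n - n * r) / r) * c powr (1 / r)) * ennreal_powr ?I (1 / r)"
    by (intro mult_right_mono ennreal_leI mult_left_mono) (auto simp: max_def)
  \<comment> \<open>This is \<open>n/r - n = -n (1 - 1/r)\<close>, and \<open>1 - 1/r\<close> is the
    reciprocal of the conjugate exponent.\<close>
  also have "(n - n * r) / r = - (n * recip (conjugate_exponent p))"
    using r by (simp add: recip_conjugate_exponent[OF p] recip field_simps)
  finally show ?thesis
    using real r by (simp add: weighted_Lp_norm_def recip_ennreal n_def)
qed

text \<open>For finite \<open>p\<close> the two sides are equal, since the power \<open>p\<close> of
  \<open>v powr recip p\<close> is \<open>v\<close>. At \<open>p = \<infinity>\<close> the factor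
  \<open>v powr 0\<close> is 1 wherever \<open>v > 0\<close>, and the weighted essential supremum
  sees no other points.\<close>

lemma weighted_Lp_norm_le_Lp_norm:
  fixes f :: "'a::euclidean_space \<Rightarrow> complex"
  assumes f: "f \<in> borel_measurable borel"
    and v[measurable]: "v \<in> borel_measurable lebesgue" and v0: "\<And>x. 0 \<le> v x" and p: "1 \<le> p"
  shows "weighted_Lp_norm p lebesgue v f \<le> Lp_norm p (\<lambda>x. complex_of_real (v x powr recip p) * f x)"
proof (cases p)
  case top
  have [measurable]: "f \<in> borel_measurable lebesgue"
    using f by (auto intro: measurable_completion)
  let ?E = "Lp_norm p (\<lambda>x. complex_of_real (v x powr recip p) * f x)"
  have "AE x in lebesgue. 0 < (1::real) \<longrightarrow>
      ennreal (norm (complex_of_real (v x powr recip p) * f x)) \<le> ?E"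
    unfolding top by (rule AE_le_weighted_Lp_norm_top) measurable
  then have "AE x in lebesgue. 0 < v x \<longrightarrow> ennreal (norm (f x)) \<le> ?E"
    by eventually_elim (auto simp: top)
  then show ?thesis
    unfolding top by (intro weighted_Lp_norm_top_leI) measurable
next
  case (real r)
  have r: "1 \<le> r"
    using p real by (simp flip: ennreal_1)
  have recip: "recip p = 1 / r"
    using real r by (simp add: recip_ennreal)
  have "norm (complex_of_real (v x powr (1 / r)) * f x) powr r = norm (f x) powr r * v x" for x
    using r v0[of x] by (simp add: norm_mult powr_mult powr_powr mult.commute)
  then show ?thesis
    using real r unfolding recip by (simp add: weighted_Lp_norm_def)
qed

section \<open>Radial weights\<close>

lemma AE_lebesgue_on_iff:
  "S \<in> sets lebesgue \<Longrightarrow> (AE x in lebesgue_on S. P x) \<longleftrightarrow> (AE x in lborel. x \<in> S \<longrightarrow> P x)"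
  by (subst AE_restrict_space_iff) (simp_all add: AE_completion_iff)

lemma sphere_direction_polar:
  "0 < \<rho> \<Longrightarrow> norm \<omega> = 1 \<Longrightarrow> sphere_direction (\<rho> *\<^sub>R \<omega>) = \<omega>"
  by (auto simp: sphere_direction_def)

lemma AE_sphere_measure_norm: "AE \<omega> in sphere_measure. norm \<omega> = 1"
  by (rule AE_I2) (simp add: space_sphere_measure)

text \<open>The cone over a null set of directions is null, by polar coordinates. As
  \<open>R\<close> may fail to be measurable, its failure set is first covered by a measurable null
  set \<open>N\<close>.\<close>

lemma AE_lborel_sphere_direction:
  fixes R :: "'a::euclidean_space \<Rightarrow> bool"
  assumes "AE \<omega> in sphere_measure. R \<omega>"
  shows "AE x in lborel. R (sphere_direction x)"
proof -
  obtain N :: "'a set" where N: "{\<omega> \<in> space sphere_measure. \<not> R \<omega>} \<subseteq> N"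
      "emeasure sphere_measure N = 0" "N \<in> sets sphere_measure"
    using assms by (rule AE_E)
  have [measurable]: "N \<in> sets sphere_measure" by fact
  have "AE \<omega> in sphere_measure. \<omega> \<notin> N"
    using N by (intro AE_not_in) auto
  then have *: "AE \<omega> in sphere_measure. sphere_direction (\<rho> *\<^sub>R \<omega>) \<notin> N" if "0 < \<rho>" for \<rho>
    using AE_sphere_measure_norm by eventually_elim (simp add: sphere_direction_polar that)
  have "AE x in lborel. sphere_direction x \<notin> N"
    by (subst AE_polar_iff) (auto simp: AE_radial_measure_iff *)
  moreover have "R \<omega>" if "norm \<omega> = 1" "\<omega> \<notin> N" for \<omega>
    using that N(1) by (auto simp: space_sphere_measure)
  ultimately show ?thesis
    by (auto elim!: eventually_mono)
qed

text \<open>The counterpart for radii: the union of the spheres with radii in a null set is null.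
  The origin is excluded because only positive radii are controlled.\<close>

lemma AE_lborel_norm:
  assumes "AE \<rho> in lborel. 0 < \<rho> \<longrightarrow> R \<rho>"
  shows "AE x in lborel. x \<noteq> 0 \<longrightarrow> R (norm (x::'a::euclidean_space))"
proof -
  obtain N where N: "{\<rho> \<in> space lborel. \<not> (0 < \<rho> \<longrightarrow> R \<rho>)} \<subseteq> N"
      "emeasure lborel N = 0" "N \<in> sets lborel"
    using assms by (rule AE_E)
  have [measurable]: "N \<in> sets borel" using N by simp
  have "AE \<rho> in lborel. \<rho> \<notin> N"
    using N by (intro AE_not_in) auto
  then have "AE \<rho> in lborel. 0 < \<rho> \<longrightarrow> (AE \<omega> in sphere_measure. norm (\<rho> *\<^sub>R (\<omega>::'a)) \<notin> N)"
  proof eventually_elim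
    case (elim \<rho>)
    then show ?case
      using AE_sphere_measure_norm[where 'a='a] by (auto elim!: eventually_mono)
  qed
  then have "AE x::'a in lborel. norm x \<notin> N"
    by (subst AE_polar_iff) (auto simp: AE_radial_measure_iff)
  moreover have "R \<rho>" if "0 < \<rho>" "\<rho> \<notin> N" for \<rho>
    using that N(1) by auto
  ultimately show ?thesis
    by (auto elim!: eventually_mono)
qed

lemma measure_sphere_measure_pos:
  "0 < measure sphere_measure (sphere 0 1 :: 'a::euclidean_space set)"
  by (simp add: measure_def emeasure_sphere_measure_space unit_ball_vol_pos)

text \<open>The Borel representative of the profile is the spherical mean of a Borel representative of \<open>u\<close>.\<close>

lemma radial_profile_borel:
  fixes u :: "'a::euclidean_space \<Rightarrow> real"
  assumes u: "u \<in> borel_measurable lebesgue" and radial: "\<And>x. u x = u0 (norm x)"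
  obtains u0' where "u0' \<in> borel_measurable borel" "AE \<rho> in lborel. 0 < \<rho> \<longrightarrow> u0 \<rho> = u0' \<rho>"
proof -
  interpret finite_measure "sphere_measure :: 'a measure"
    by (rule finite_measure_sphere_measure)
  obtain u' where u': "u' \<in> borel_measurable lborel" "AE x in lborel. u x = u' x"
    using completion_ex_borel_measurable_real[OF u] by blast
  then have [measurable]: "u' \<in> borel_measurable borel" by simp
  obtain N where N: "{x \<in> space lborel. \<not> u x = u' x} \<subseteq> N"
      "emeasure lborel N = 0" "N \<in> sets lborel"
    using u'(2) by (rule AE_E)
  have [measurable]: "N \<in> sets borel" using N by simp
  have "AE x in lborel. x \<notin> N"
    using N by (intro AE_not_in) auto
  \<comment> \<open>By polar coordinates almost every sphere meets \<open>N\<close> in a null set.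
    On such a sphere \<open>u'\<close> equals the constant \<open>u0 \<rho>\<close> almost
    everywhere, so its mean is \<open>u0 \<rho>\<close>.\<close>
  then have "AE \<rho> in lborel. 0 < \<rho> \<longrightarrow> (AE \<omega> in sphere_measure. \<rho> *\<^sub>R \<omega> \<notin> N)"
    by (subst (asm) AE_polar_iff) (auto simp: AE_radial_measure_iff)
  then have "AE \<rho> in lborel. 0 < \<rho> \<longrightarrow> u0 \<rho> =
      (LINT \<omega>|sphere_measure. u' (\<rho> *\<^sub>R \<omega>)) / measure sphere_measure (sphere 0 1 :: 'a set)"
  proof (eventually_elim, intro impI)
    fix \<rho> :: real assume "0 < \<rho> \<longrightarrow> (AE \<omega> in sphere_measure. \<rho> *\<^sub>R \<omega> \<notin> N)" "0 < \<rho>"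
    then have ae: "AE \<omega> in sphere_measure. \<rho> *\<^sub>R \<omega> \<notin> N" by blast
    have "AE \<omega> in sphere_measure. u' (\<rho> *\<^sub>R \<omega>) = u0 \<rho>"
      using ae AE_sphere_measure_norm
    proof eventually_elim
      case (elim \<omega>)
      then have "u (\<rho> *\<^sub>R \<omega>) = u' (\<rho> *\<^sub>R \<omega>)" using N(1) by auto
      then show ?case using elim \<open>0 < \<rho>\<close> by (simp add: radial)
    qed
    then have "(LINT \<omega>|sphere_measure. u' (\<rho> *\<^sub>R \<omega>)) = (LINT \<omega>|(sphere_measure :: 'a measure). u0 \<rho>)"
      by (intro integral_cong_AE) auto
    then show "u0 \<rho> = (LINT \<omega>|sphere_measure. u' (\<rho> *\<^sub>R \<omega>)) / measure sphere_measure (sphere 0 1 :: 'a set)"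
      using measure_sphere_measure_pos[where 'a='a] by (simp add: space_sphere_measure)
  qed
  then show ?thesis
    by (rule that[rotated]) measurable
qed

text \<open>Integrates bounds on spheres over the radius. It is applied with \<open>g\<close> the
  Fourier transform, \<open>K \<rho>\<close> the growth factor under dilation and \<open>B\<close> a
  multiple of the norm of \<open>f\<close>. For finite \<open>q\<close> the inner integral is the
  power \<open>q\<close> of the spherical norm, at most that of \<open>K \<rho>\<close> times that
  of \<open>B\<close>.\<close>

lemma weighted_Lp_norm_polar_le:
  fixes U u :: "'a::euclidean_space \<Rightarrow> real" and g :: "'a \<Rightarrow> complex"
  assumes U: "U \<in> borel_measurable (completion sphere_measure)" "\<And>\<omega>. norm \<omega> = 1 \<Longrightarrow> 0 \<le> U \<omega>"
    and u: "u \<in> borel_measurable lebesgue" "\<And>x. 0 \<le> u x"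
    and radial: "\<And>x. u x = u0 (norm x)"
    and g[measurable]: "g \<in> borel_measurable borel"
    and K: "K \<in> borel_measurable (lebesgue_on {0<..})" "\<And>\<rho>. 0 \<le> K \<rho>"
    and q: "0 < q"
    and bound: "AE \<rho> in lebesgue_on {0<..}.
      weighted_Lp_norm q (completion sphere_measure) U (\<lambda>\<omega>. g (\<rho> *\<^sub>R \<omega>)) \<le> ennreal (K \<rho>) * B"
  shows "weighted_Lp_norm q lebesgue (\<lambda>x. U (x /\<^sub>R norm x) * u x) g \<le>
    weighted_Lp_norm q (lebesgue_on {0<..})
      (\<lambda>\<rho>. \<rho> powr (real DIM('a) - 1) * u0 \<rho>) (\<lambda>\<rho>. complex_of_real (K \<rho>)) * B"
proof -
  interpret finite_measure "sphere_measure :: 'a measure"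
    by (rule finite_measure_sphere_measure)
  \<comment> \<open>Polar coordinates are available for Borel functions only, so both weights are
    replaced by Borel representatives.\<close>
  obtain U' where U'[measurable]: "U' \<in> borel_measurable sphere_measure"
      and UU': "AE \<omega> in sphere_measure. U \<omega> = U' \<omega>"
    using completion_ex_borel_measurable_real[OF U(1)] by blast
  obtain u0' where u0'[measurable]: "u0' \<in> borel_measurable borel"
      and u0u0': "AE \<rho> in lborel. 0 < \<rho> \<longrightarrow> u0 \<rho> = u0' \<rho>"
    using radial_profile_borel[OF u(1) radial] by blast
  \<comment> \<open>The sign of \<open>u0\<close> is known only through \<open>u\<close>; every
    radius \<open>\<rho> \<ge> 0\<close> is the norm of some multiple of a basis vector.\<close>
  have u0_nonneg: "0 \<le> u0 \<rho>" if "0 \<le> \<rho>" for \<rho>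
  proof -
    obtain b :: 'a where "b \<in> Basis" using nonempty_Basis by blast
    then show ?thesis
      using u(2)[of "\<rho> *\<^sub>R b"] that by (simp add: radial)
  qed
  define W where "W x = U (x /\<^sub>R norm x) * u x" for x
  have W: "AE x in lborel. W x = U' (sphere_direction x) * u0' (norm x)"
    using AE_lborel_sphere_direction[OF UU'] AE_lborel_norm[OF u0u0', where 'a='a]
      AE_lborel_singleton[of 0]
    by eventually_elim (auto simp: W_def sphere_direction_nonzero radial)
  have W_measurable[measurable]: "W \<in> borel_measurable lebesgue"
  proof (rule borel_measurable_AE)
    show "AE x in lebesgue. U' (sphere_direction x) * u0' (norm x) = W x"
      using W by (simp add: AE_completion_iff eq_commute)
    show "(\<lambda>x. U' (sphere_direction x) * u0' (norm x)) \<in> borel_measurable lebesgue"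
      by (rule measurable_completion) simp
  qed
  have u0_measurable[measurable]: "u0 \<in> borel_measurable (lebesgue_on {0<..})"
  proof (subst borel_measurable_restrict_space_iff)
    show "(\<lambda>\<rho>. indicator {0<..} \<rho> *\<^sub>R u0 \<rho>) \<in> borel_measurable lebesgue"
    proof (rule borel_measurable_AE)
      show "AE \<rho> in lebesgue. indicator {0<..} \<rho> *\<^sub>R u0' \<rho> = indicator {0<..} \<rho> *\<^sub>R u0 \<rho>"
        using u0u0' by (auto simp: AE_completion_iff indicator_def elim!: eventually_mono)
    qed (rule measurable_completion, simp)
  qed simp
  have bound': "AE \<rho> in lborel. 0 < \<rho> \<longrightarrow>
      weighted_Lp_norm q (completion sphere_measure) U (\<lambda>\<omega>. g (\<rho> *\<^sub>R \<omega>)) \<le> ennreal (K \<rho>) * B"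
    using bound by (simp add: AE_lebesgue_on_iff)
  have powr_pred: "\<rho> powr (real DIM('a) - 1) = \<rho> ^ (DIM('a) - 1)" if "0 < \<rho>" for \<rho>
    using that DIM_positive[where 'a='a] by (simp add: of_nat_diff Suc_leI flip: powr_realpow)
  let ?w = "\<lambda>\<rho>. \<rho> powr (real DIM('a) - 1) * u0 \<rho>"
  have w_measurable: "?w \<in> borel_measurable (lebesgue_on {0<..})"
    by (intro borel_measurable_times u0_measurable measurable_restrict_space1 measurable_completion) simp
  show ?thesis
  proof (cases q)
    case top
    let ?E = "weighted_Lp_norm top (lebesgue_on {0<..}) ?w (\<lambda>\<rho>. complex_of_real (K \<rho>))"
    have E: "AE \<rho> in lborel. 0 < \<rho> \<longrightarrow> 0 < ?w \<rho> \<longrightarrow> ennreal (K \<rho>) \<le> ?E"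
      using AE_le_weighted_Lp_norm_top[OF w_measurable, of "\<lambda>\<rho>. complex_of_real (K \<rho>)"] K(2)
      by (simp add: AE_lebesgue_on_iff)
    \<comment> \<open>Stated with \<open>U'\<close> and \<open>u0'\<close> so that the predicate is
      Borel. Where both weights are positive, the bound on the sphere gives
      \<open>K \<rho> * B\<close>, and positivity of the radial weight gives
      \<open>K \<rho> \<le> ?E\<close>.\<close>
    have "AE x in lborel. 0 < u0' (norm x) \<longrightarrow> 0 < U' (sphere_direction x) \<longrightarrow>
        ennreal (norm (g x)) \<le> ?E * B"
    proof (subst AE_polar_iff, simp, unfold AE_radial_measure_iff)
      show "AE \<rho> in lborel. 0 < \<rho> \<longrightarrow> (AE \<omega> in sphere_measure. 0 < u0' (norm (\<rho> *\<^sub>R (\<omega>::'a))) \<longrightarrow>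
          0 < U' (sphere_direction (\<rho> *\<^sub>R \<omega>)) \<longrightarrow> ennreal (norm (g (\<rho> *\<^sub>R \<omega>))) \<le> ?E * B)"
        using E bound' u0u0'
      proof (eventually_elim, intro impI)
        fix \<rho> :: real
        assume \<rho>: "0 < \<rho>" and 1: "0 < \<rho> \<longrightarrow> 0 < ?w \<rho> \<longrightarrow> ennreal (K \<rho>) \<le> ?E"
          and 2: "0 < \<rho> \<longrightarrow> weighted_Lp_norm q (completion sphere_measure) U (\<lambda>\<omega>. g (\<rho> *\<^sub>R \<omega>)) \<le> ennreal (K \<rho>) * B"
          and 3: "0 < \<rho> \<longrightarrow> u0 \<rho> = u0' \<rho>"
        have "AE \<omega> in completion sphere_measure. 0 < U \<omega> \<longrightarrow> ennreal (norm (g (\<rho> *\<^sub>R \<omega>))) \<le>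
            weighted_Lp_norm top (completion sphere_measure) U (\<lambda>\<omega>. g (\<rho> *\<^sub>R \<omega>))"
          by (rule AE_le_weighted_Lp_norm_top[OF U(1)])
        then have "AE \<omega> in sphere_measure. 0 < U \<omega> \<longrightarrow> ennreal (norm (g (\<rho> *\<^sub>R \<omega>))) \<le>
            weighted_Lp_norm top (completion sphere_measure) U (\<lambda>\<omega>. g (\<rho> *\<^sub>R \<omega>))"
          by (simp add: AE_completion_iff)
        then show "AE \<omega> in sphere_measure. 0 < u0' (norm (\<rho> *\<^sub>R (\<omega>::'a))) \<longrightarrow>
          0 < U' (sphere_direction (\<rho> *\<^sub>R \<omega>)) \<longrightarrow> ennreal (norm (g (\<rho> *\<^sub>R \<omega>))) \<le> ?E * B"
          using UU' AE_sphere_measure_norm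
        proof (eventually_elim, intro impI)
          fix \<omega> :: 'a
          assume a: "0 < U \<omega> \<longrightarrow> ennreal (norm (g (\<rho> *\<^sub>R \<omega>))) \<le>
              weighted_Lp_norm top (completion sphere_measure) U (\<lambda>\<omega>. g (\<rho> *\<^sub>R \<omega>))"
            and b: "U \<omega> = U' \<omega>" "norm \<omega> = 1"
            and c: "0 < u0' (norm (\<rho> *\<^sub>R \<omega>))" "0 < U' (sphere_direction (\<rho> *\<^sub>R \<omega>))"
          have "0 < U \<omega>" "0 < u0 \<rho>"
            using b c \<rho> 3 by (simp_all add: sphere_direction_polar)
          then have "ennreal (norm (g (\<rho> *\<^sub>R \<omega>))) \<le> ennreal (K \<rho>) * B"
            using a 2 \<rho> by (auto simp: top intro: order.trans)
          also have "\<dots> \<le> ?E * B"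
            using 1 \<rho> \<open>0 < u0 \<rho>\<close> by (intro mult_right_mono) auto
          finally show "ennreal (norm (g (\<rho> *\<^sub>R \<omega>))) \<le> ?E * B" .
        qed
      qed
    qed
    then have "AE x in lborel. 0 < W x \<longrightarrow> ennreal (norm (g x)) \<le> ?E * B"
      using AE_lborel_sphere_direction[OF UU'] AE_lborel_norm[OF u0u0', where 'a='a]
        AE_lborel_singleton[of 0]
    proof (eventually_elim, intro impI)
      fix x :: 'a
      assume a: "0 < u0' (norm x) \<longrightarrow> 0 < U' (sphere_direction x) \<longrightarrow> ennreal (norm (g x)) \<le> ?E * B"
        and b: "U (sphere_direction x) = U' (sphere_direction x)"
          "x \<noteq> 0 \<longrightarrow> u0 (norm x) = u0' (norm x)" "x \<noteq> 0" and c: "0 < W x"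
      \<comment> \<open>Both factors are nonnegative, so a positive product forces each of them to
        be positive.\<close>
      have "0 \<le> U (sphere_direction x)" "0 \<le> u0 (norm x)"
        by (auto intro: U(2) u0_nonneg)
      moreover have "0 < U (sphere_direction x) * u0 (norm x)"
        using b c by (simp add: W_def radial sphere_direction_nonzero)
      ultimately show "ennreal (norm (g x)) \<le> ?E * B"
        using a b by (auto simp: zero_less_mult_iff)
    qed
    then have "weighted_Lp_norm top lebesgue W g \<le> ?E * B"
      by (intro weighted_Lp_norm_top_leI measurable_completion[of g]) (auto simp: AE_completion_iff)
    then show ?thesis
      by (simp add: top W_def[abs_def])
  next
    case (real s)
    with q have s: "0 < s" by simp
    define D where "D = ennreal_powr B s"
    let ?I = "\<integral>\<^sup>+\<rho>. ennreal (K \<rho> powr s * ?w \<rho>) \<partial>lebesgue_on {0<..}"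
    let ?F = "\<lambda>x. ennreal (norm (g x) powr s * (U' (sphere_direction x) * u0' (norm x)))"
    let ?\<Phi> = "\<lambda>\<rho>. \<integral>\<^sup>+\<omega>. ?F (\<rho> *\<^sub>R \<omega>) \<partial>sphere_measure"
    have "(\<integral>\<^sup>+x. ennreal (norm (g x) powr s * W x) \<partial>lebesgue) =
        (\<integral>\<^sup>+x. ennreal (norm (g x) powr s * W x) \<partial>lborel)"
      by (rule nn_integral_completion)
    also have "\<dots> = (\<integral>\<^sup>+x. ?F x \<partial>lborel)"
      using W by (intro nn_integral_cong_AE) (auto elim!: eventually_mono)
    also have "\<dots> = (\<integral>\<^sup>+\<rho>. ?\<Phi> \<rho> \<partial>radial_measure DIM('a))"
      by (rule nn_integral_polar) simp
    also have "\<dots> = (\<integral>\<^sup>+\<rho>. ennreal (\<rho> ^ (DIM('a) - 1)) * indicator {0<..} \<rho> * ?\<Phi> \<rho> \<partial>lborel)"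
      by (rule nn_integral_radial_measure) measurable
    \<comment> \<open>Back to the completed measure, in which the norm of \<open>K\<close> is
      stated.\<close>
    also have "\<dots> = (\<integral>\<^sup>+\<rho>. (ennreal (\<rho> ^ (DIM('a) - 1)) * ?\<Phi> \<rho>) * indicator {0<..} \<rho> \<partial>lebesgue)"
      by (subst nn_integral_completion) (simp add: mult_ac)
    also have "\<dots> = (\<integral>\<^sup>+\<rho>. ennreal (\<rho> ^ (DIM('a) - 1)) * ?\<Phi> \<rho> \<partial>lebesgue_on {0<..})"
      by (subst nn_integral_restrict_space) simp_all
    also have "\<dots> \<le> (\<integral>\<^sup>+\<rho>. ennreal (K \<rho> powr s * ?w \<rho>) * D \<partial>lebesgue_on {0<..})"
    proof (intro nn_integral_mono_AE, subst AE_lebesgue_on_iff, simp)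
      show "AE \<rho> in lborel. \<rho> \<in> {0<..} \<longrightarrow>
          ennreal (\<rho> ^ (DIM('a) - 1)) * ?\<Phi> \<rho> \<le> ennreal (K \<rho> powr s * ?w \<rho>) * D"
        using bound' u0u0'
      proof (eventually_elim, intro impI)
        fix \<rho> :: real
        assume "\<rho> \<in> {0<..}"
          and 2: "0 < \<rho> \<longrightarrow> weighted_Lp_norm q (completion sphere_measure) U (\<lambda>\<omega>. g (\<rho> *\<^sub>R \<omega>)) \<le> ennreal (K \<rho>) * B"
          and 3: "0 < \<rho> \<longrightarrow> u0 \<rho> = u0' \<rho>"
        then have \<rho>: "0 < \<rho>" by simp
        let ?J = "\<integral>\<^sup>+\<omega>. ennreal (norm (g (\<rho> *\<^sub>R \<omega>)) powr s * U \<omega>) \<partial>sphere_measure"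
        have "ennreal_powr ?J (1 / s) \<le> ennreal (K \<rho>) * B"
          using 2 \<rho> real by (simp add: weighted_Lp_norm_def nn_integral_completion)
        then have "ennreal_powr (ennreal_powr ?J (1 / s)) s \<le> ennreal_powr (ennreal (K \<rho>) * B) s"
          using s by (intro ennreal_powr_mono) auto
        then have J: "?J \<le> ennreal (K \<rho> powr s) * D"
          using s K(2) by (simp add: ennreal_powr_powr ennreal_powr_mult ennreal_powr_ennreal D_def)
        \<comment> \<open>The radial weight is constant on the sphere of radius
          \<open>\<rho>\<close> and leaves the inner integral.\<close>
        have "?\<Phi> \<rho> = (\<integral>\<^sup>+\<omega>. ennreal (u0 \<rho>) * ennreal (norm (g (\<rho> *\<^sub>R \<omega>)) powr s * U' \<omega>) \<partial>sphere_measure)"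
        proof (rule nn_integral_cong_AE)
          show "AE \<omega> in sphere_measure. ?F (\<rho> *\<^sub>R \<omega>) =
              ennreal (u0 \<rho>) * ennreal (norm (g (\<rho> *\<^sub>R \<omega>)) powr s * U' \<omega>)"
            using AE_sphere_measure_norm
          proof eventually_elim
            case (elim \<omega>)
            then show ?case
              using \<rho> 3 u0_nonneg[of \<rho>]
              by (simp add: sphere_direction_polar mult_ac flip: ennreal_mult')
          qed
        qed
        also have "\<dots> = ennreal (u0 \<rho>) *
            (\<integral>\<^sup>+\<omega>. ennreal (norm (g (\<rho> *\<^sub>R \<omega>)) powr s * U' \<omega>) \<partial>sphere_measure)"
          by (rule nn_integral_cmult) measurable
        also have "(\<integral>\<^sup>+\<omega>. ennreal (norm (g (\<rho> *\<^sub>R \<omega>)) powr s * U' \<omega>) \<partial>sphere_measure) = ?J"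
          using UU' by (intro nn_integral_cong_AE) (auto elim!: eventually_mono)
        finally have "ennreal (\<rho> ^ (DIM('a) - 1)) * ?\<Phi> \<rho> = ennreal (?w \<rho>) * ?J"
          using \<rho> u0_nonneg[of \<rho>] by (simp add: powr_pred ennreal_mult mult.assoc)
        also have "\<dots> \<le> ennreal (?w \<rho>) * (ennreal (K \<rho> powr s) * D)"
          using J by (intro mult_left_mono) auto
        also have "\<dots> = ennreal (K \<rho> powr s * ?w \<rho>) * D"
          using \<rho> u0_nonneg[of \<rho>] by (simp add: ennreal_mult mult_ac)
        finally show "ennreal (\<rho> ^ (DIM('a) - 1)) * ?\<Phi> \<rho> \<le> ennreal (K \<rho> powr s * ?w \<rho>) * D" .
      qed
    qed
    also have "\<dots> = ?I * D"
      using w_measurable K(1) by (intro nn_integral_multc) simp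
    finally have "ennreal_powr (\<integral>\<^sup>+x. ennreal (norm (g x) powr s * W x) \<partial>lebesgue) (1 / s) \<le>
        ennreal_powr (?I * D) (1 / s)"
      using s by (intro ennreal_powr_mono) auto
    also have "\<dots> = ennreal_powr ?I (1 / s) * B"
      using s by (simp add: ennreal_powr_mult D_def ennreal_powr_powr)
    finally show ?thesis
      using s real K(2) by (simp add: weighted_Lp_norm_def W_def)
  qed
qed

text \<open>At \<open>q = \<infinity>\<close> the integral condition takes the form of a finite
  essential supremum, the \<open>L\<^sup>q\<close> condition on the same dilation factor with the
  same radial weight.\<close>

theorem theorem3p1:
  fixes U v u :: "real ^ 'n \<Rightarrow> real" and u0 w :: "real \<Rightarrow> real" and p q :: ennreal
  assumes n: "CARD('n) \<ge> 2"
    and U: "U \<in> borel_measurable (completion sphere_measure)" "\<And>\<omega>. norm \<omega> = 1 \<Longrightarrow> 0 \<le> U \<omega>"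
    and v: "v \<in> borel_measurable lebesgue" "\<And>x. 0 \<le> v x"
    and pq: "1 \<le> p" "p \<le> q" "q \<le> \<infinity>"
    and restriction: "\<exists>C>0. \<forall>f\<in>test_functions.
        weighted_Lp_norm q (completion sphere_measure) U (fourier f)
          \<le> ennreal C * weighted_Lp_norm p lebesgue v f"
    and w: "w \<in> borel_measurable (lebesgue_on {0<..})"
    and dilation: "AE \<rho> in lebesgue_on {0<..}. AE x in lebesgue. v (\<rho> *\<^sub>R x) \<le> w \<rho> * v x"
    and u: "u \<in> borel_measurable lebesgue" "\<And>x. 0 \<le> u x"
    and radial: "\<And>x. u x = u0 (norm x)"
    and finite_q: "q < \<infinity> \<Longrightarrow>
        (\<integral>\<^sup>+\<rho>. ennreal (\<rho> powr (real CARD('n) - 1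
                      - enn2real q * real CARD('n) * recip (conjugate_exponent p))
                    * u0 \<rho> * w \<rho> powr (enn2real q / enn2real p)) \<partial>lebesgue_on {0<..}) < \<infinity>"
    and infinite_q: "q = \<infinity> \<Longrightarrow>
        esssup (density (lebesgue_on {0<..}) (\<lambda>\<rho>. ennreal (\<rho> powr (real CARD('n) - 1) * u0 \<rho>)))
          (\<lambda>\<rho>. ennreal (\<rho> powr (- (real CARD('n) * recip (conjugate_exponent p)))
                   * w \<rho> powr recip p)) < \<infinity>"
  shows "\<exists>C>0. \<forall>f\<in>test_functions.
      weighted_Lp_norm q lebesgue (\<lambda>x. U (x /\<^sub>R norm x) * u x) (fourier f)
        \<le> ennreal C * Lp_norm p (\<lambda>x. complex_of_real (v x powr recip p) * f x)"
proof -
  obtain C where C: "0 < C" and rest: "\<And>f. f \<in> test_functions \<Longrightarrow>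
      weighted_Lp_norm q (completion sphere_measure) U (fourier f) \<le> ennreal C * weighted_Lp_norm p lebesgue v f"
    using restriction by blast
  \<comment> \<open>\<open>K \<rho>\<close> is the factor of
    \<open>weighted_Lp_norm_dilate_le\<close> for \<open>c = w \<rho>\<close>.\<close>
  define a where "a = - (real CARD('n) * recip (conjugate_exponent p))"
  define K where "K \<rho> = \<rho> powr a * w \<rho> powr recip p" for \<rho>
  define A where "A = weighted_Lp_norm q (lebesgue_on {0<..})
      (\<lambda>\<rho>. \<rho> powr (real CARD('n) - 1) * u0 \<rho>) (\<lambda>\<rho>. complex_of_real (K \<rho>))"
  have K_measurable: "K \<in> borel_measurable (lebesgue_on {0<..})"
  proof -
    have "(\<lambda>\<rho>. \<rho> powr a) \<in> borel_measurable (lebesgue_on {0<..})"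
      by (intro measurable_restrict_space1 measurable_completion) simp
    with w show ?thesis
      unfolding K_def[abs_def] by measurable
  qed
  have K_nonneg: "0 \<le> K \<rho>" for \<rho>
    by (simp add: K_def)
  have q: "0 < q"
    using pq by (meson less_le_trans zero_less_one)
  have "A < \<infinity>"
  proof (cases q)
    case top
    then show ?thesis
      using infinite_q K_nonneg by (simp add: A_def weighted_Lp_norm_def K_def a_def norm_mult)
  next
    case (real s)
    with q have s: "0 < s" by simp
    \<comment> \<open>A finite \<open>q\<close> forces \<open>p\<close> to be finite, because
      \<open>p \<le> q\<close>.\<close>
    from pq(2) real obtain r where r: "p = ennreal r" "0 \<le> r"
      by (cases p) (auto simp: top_unique)
    with pq(1) have "1 \<le> r"
      by (simp flip: ennreal_1)
    with r have recip: "recip p = 1 / r"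
      by (simp add: recip_ennreal)
    have "(\<integral>\<^sup>+\<rho>. ennreal (K \<rho> powr s * (\<rho> powr (real CARD('n) - 1) * u0 \<rho>)) \<partial>lebesgue_on {0<..}) =
        (\<integral>\<^sup>+\<rho>. ennreal (\<rho> powr (real CARD('n) - 1 - s * real CARD('n) * recip (conjugate_exponent p))
          * u0 \<rho> * w \<rho> powr (s / r)) \<partial>lebesgue_on {0<..})" (is "?I = ?I'")
    proof (rule nn_integral_cong)
      fix \<rho> :: real assume "\<rho> \<in> space (lebesgue_on {0<..})"
      then have "0 < \<rho>" by simp
      have "K \<rho> powr s = \<rho> powr (a * s) * w \<rho> powr (s / r)"
        by (simp add: K_def recip powr_mult powr_powr)
      moreover have "\<rho> powr (real CARD('n) - 1 - s * real CARD('n) * recip (conjugate_exponent p)) =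
          \<rho> powr (a * s) * \<rho> powr (real CARD('n) - 1)"
        by (simp add: a_def mult_ac flip: powr_add)
      ultimately show "ennreal (K \<rho> powr s * (\<rho> powr (real CARD('n) - 1) * u0 \<rho>)) =
          ennreal (\<rho> powr (real CARD('n) - 1 - s * real CARD('n) * recip (conjugate_exponent p))
          * u0 \<rho> * w \<rho> powr (s / r))"
        by (simp add: mult_ac)
    qed
    also have "?I' < \<infinity>"
      using finite_q real s r by simp
    finally have "ennreal_powr ?I (1 / s) < \<infinity>"
      by (cases ?I) (auto simp: ennreal_powr_ennreal)
    then show ?thesis
      using real s K_nonneg by (simp add: A_def weighted_Lp_norm_def)
  qed
  then obtain b where b: "0 \<le> b" "A = ennreal b"
    by (cases A) auto
  have "weighted_Lp_norm q lebesgue (\<lambda>x. U (x /\<^sub>R norm x) * u x) (fourier f) \<le>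
      ennreal (C * (b + 1)) * Lp_norm p (\<lambda>x. complex_of_real (v x powr recip p) * f x)"
    if f: "f \<in> test_functions" for f
  proof -
    have [measurable]: "f \<in> borel_measurable borel"
      using f by (rule test_functions_measurable)
    let ?N = "weighted_Lp_norm p lebesgue v f"
    have "AE \<rho> in lebesgue_on {0<..}.
        weighted_Lp_norm q (completion sphere_measure) U (\<lambda>\<omega>. fourier f (\<rho> *\<^sub>R \<omega>)) \<le>
          ennreal (K \<rho>) * (ennreal C * ?N)"
      \<comment> \<open>The underlying space is the positive half-line, so \<open>AE_space\<close>
        supplies \<open>0 < \<rho>\<close>.\<close>
      using dilation AE_space
    proof eventually_elim
      case (elim \<rho>)
      then have \<rho>: "0 < \<rho>" by simp
      have "(\<lambda>\<omega>. fourier f (\<rho> *\<^sub>R \<omega>)) = fourier (dilate \<rho> f)"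
        using \<rho> by (simp add: fourier_dilate fun_eq_iff)
      then have "weighted_Lp_norm q (completion sphere_measure) U (\<lambda>\<omega>. fourier f (\<rho> *\<^sub>R \<omega>)) =
          weighted_Lp_norm q (completion sphere_measure) U (fourier (dilate \<rho> f))"
        by (rule arg_cong)
      also have "\<dots> \<le> ennreal C * weighted_Lp_norm p lebesgue v (dilate \<rho> f)"
        using f \<rho> by (intro rest dilate_in_test_functions)
      also have "\<dots> \<le> ennreal C * (ennreal (K \<rho>) * ?N)"
        using weighted_Lp_norm_dilate_le[OF _ v pq(1) \<rho> elim(1), of f]
        by (intro mult_left_mono) (simp_all add: K_def a_def)
      finally show ?case by (simp add: mult_ac)
    qed
    from weighted_Lp_norm_polar_le[OF U u radial _ K_measurable K_nonneg q this]
    have "weighted_Lp_norm q lebesgue (\<lambda>x. U (x /\<^sub>R norm x) * u x) (fourier f) \<le>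
        A * (ennreal C * ?N)"
      by (simp add: A_def)
    \<comment> \<open>With \<open>b + 1\<close> in place of \<open>b\<close> the constant is
      strictly positive even if \<open>A = 0\<close>.\<close>
    also have "\<dots> \<le> ennreal (b + 1) * (ennreal C * Lp_norm p (\<lambda>x. complex_of_real (v x powr recip p) * f x))"
      unfolding b(2) by (intro mult_mono ennreal_leI weighted_Lp_norm_le_Lp_norm v pq(1)) auto
    also have "\<dots> = ennreal (C * (b + 1)) * Lp_norm p (\<lambda>x. complex_of_real (v x powr recip p) * f x)"
      using C b(1) by (simp add: ennreal_mult mult_ac)
    finally show ?thesis .
  qed
  then show ?thesis
    using C b(1) by (intro exI[of _ "C * (b + 1)"]) auto
qed

end
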